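(* Let $P$ be a finite poset and $\varphi\colon P\to P$ a closure operator. Then $\Delta(P)$ $\mathrm{LC}$-reduces to $\Delta(\varphi(P))$.
   Context: $\Delta(P)$ is the order complex of $P$: the simplicial complex on vertex set $P$ whose faces are the chains of $P$; $\Delta(\varphi(P))$ is the order complex of the induced subposet $\varphi(P)$. A map $\varphi\colon P\to P$ is a closure operator if it is order-preserving, satisfies $x\le\varphi(x)$ or $x\ge\varphi(x)$ for each $x\in P$, and $\varphi^2=\varphi$. For a simplicial complex $\Delta$ with vertex set $V$, $\mathcal{F}(v)$ is the set of facets (maximal faces) containing $v$; for $\kappa\colon V\to[k]=\{1,\dots,k\}$ and a face $S$, $S_\kappa(t)=|\{v\in S:\kappa(v)=t\}|$; a $k$-linear coloring is a surjective $\kappa$ with $\sum_t\min(F_\kappa(t),F'_\kappa(t))=|F\cap F'|$ for all facets $F,F'$. A representative subcomplex w.r.t. $\kappa$ is the subcomplex $\{S\in\Delta:S\subseteq W\}$ induced on a set $W\subseteq V$ with exactly one vertex of each color such that $\mathcal{F}(x)\subseteq\mathcal{F}(y)$ whenever $x\in V$, $y\in W$, $\kappa(x)=\kappa(y)$. $\Delta$ $\mathrm{LC}$-reduces to $\Delta'$ if there is a sequence $\Delta=\Delta_0\supseteq\dots\supseteq\Delta_t=\Delta'$ ($t\ge0$) with each $\Delta_{r+1}$ a representative subcomplex of $\Delta_r$ w.r.t. some linear coloring of $\Delta_r$. *)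

theory Defs
  imports Main
begin

text \<open>A simplicial complex is represented by its set of faces (including the empty face).
  Every vertex is a face here, so the vertex set is the union of the faces.\<close>

definition vertices :: "'a set set \<Rightarrow> 'a set" where
  "vertices \<Delta> = \<Union>\<Delta>"

definition facets :: "'a set set \<Rightarrow> 'a set set" where
  "facets \<Delta> = {F \<in> \<Delta>. \<forall>G\<in>\<Delta>. F \<subseteq> G \<longrightarrow> G = F}"

definition facets_at :: "'a set set \<Rightarrow> 'a \<Rightarrow> 'a set set" where
  "facets_at \<Delta> v = {F \<in> facets \<Delta>. v \<in> F}"

definition color_count :: "('a \<Rightarrow> nat) \<Rightarrow> 'a set \<Rightarrow> nat \<Rightarrow> nat" where
  "color_count \<kappa> S t = card {v \<in> S. \<kappa> v = t}"

definition linear_coloring :: "'a set set \<Rightarrow> nat \<Rightarrow> ('a \<Rightarrow> nat) \<Rightarrow> bool" where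
  "linear_coloring \<Delta> k \<kappa> \<longleftrightarrow>
     \<kappa> ` vertices \<Delta> = {1..k} \<and>
     (\<forall>F\<in>facets \<Delta>. \<forall>F'\<in>facets \<Delta>.
        (\<Sum>t\<in>{1..k}. min (color_count \<kappa> F t) (color_count \<kappa> F' t)) = card (F \<inter> F'))"

definition representative_subcomplex ::
  "'a set set \<Rightarrow> nat \<Rightarrow> ('a \<Rightarrow> nat) \<Rightarrow> 'a set set \<Rightarrow> bool" where
  "representative_subcomplex \<Delta> k \<kappa> \<Delta>' \<longleftrightarrow>
     (\<exists>W \<subseteq> vertices \<Delta>.
        (\<forall>t\<in>{1..k}. \<exists>!y. y \<in> W \<and> \<kappa> y = t) \<and>
        (\<forall>x\<in>vertices \<Delta>. \<forall>y\<in>W. \<kappa> x = \<kappa> y \<longrightarrow> facets_at \<Delta> x \<subseteq> facets_at \<Delta> y) \<and>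
        \<Delta>' = {S \<in> \<Delta>. S \<subseteq> W})"

definition LC_step :: "'a set set \<Rightarrow> 'a set set \<Rightarrow> bool" where
  "LC_step \<Delta> \<Delta>' \<longleftrightarrow>
     (\<exists>k \<kappa>. linear_coloring \<Delta> k \<kappa> \<and> representative_subcomplex \<Delta> k \<kappa> \<Delta>')"

definition LC_reduces :: "'a set set \<Rightarrow> 'a set set \<Rightarrow> bool" where
  "LC_reduces = LC_step\<^sup>*\<^sup>*"

text \<open>A poset is a carrier \<open>P\<close> with a relation \<open>r\<close>, where \<open>(x, y) \<in> r\<close> means \<open>x \<le> y\<close>.\<close>

definition order_complex :: "'a set \<Rightarrow> 'a rel \<Rightarrow> 'a set set" where
  "order_complex P r = {C. C \<subseteq> P \<and> C \<in> Chains r}"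

lemma vertices_order_complex:
  assumes "partial_order_on P r"
  shows "vertices (order_complex P r) = P"
proof
  show "vertices (order_complex P r) \<subseteq> P"
    by (auto simp: vertices_def order_complex_def)
next
  have "{x} \<in> order_complex P r" if "x \<in> P" for x
    using assms that
    by (auto simp: order_complex_def Chains_def partial_order_on_def preorder_on_def
        dest: refl_onD)
  then show "P \<subseteq> vertices (order_complex P r)"
    by (force simp: vertices_def)
qed

text \<open>Here \<open>x \<le> \<phi> x\<close> may hold for some \<open>x\<close> and \<open>\<phi> x \<le> x\<close> for others; the direction is
  not required to be the same for all \<open>x\<close>.\<close>

definition closure_operator :: "'a set \<Rightarrow> 'a rel \<Rightarrow> ('a \<Rightarrow> 'a) \<Rightarrow> bool" where
  "closure_operator P r \<phi> \<longleftrightarrow>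
     \<phi> ` P \<subseteq> P \<and>
     (\<forall>x\<in>P. \<forall>y\<in>P. (x, y) \<in> r \<longrightarrow> (\<phi> x, \<phi> y) \<in> r) \<and>
     (\<forall>x\<in>P. (x, \<phi> x) \<in> r \<or> (\<phi> x, x) \<in> r) \<and>
     (\<forall>x\<in>P. \<phi> (\<phi> x) = \<phi> x)"

end

theory Submission
  imports Defs
begin

text \<open>If every element comparable to \<open>x\<close> is comparable to \<open>y\<close>, every facet through \<open>x\<close> contains
  \<open>y\<close>, and giving \<open>x\<close> and \<open>y\<close> a common color and all other vertices distinct colors is a linear
  coloring whose representative subcomplex deletes \<open>x\<close>.  For a closure operator \<open>\<phi>\<close>, a maximal
  element \<open>x\<close> with \<open>x < \<phi> x\<close>, or dually a minimal one with \<open>\<phi> x < x\<close>, is dominated by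
  \<open>\<phi> x\<close> in this sense, so the elements not fixed by \<open>\<phi>\<close> can be deleted one at a time.\<close>

lemma min_card_eq_card_Int:
  assumes "finite A" "finite B" "A \<subseteq> B \<or> B \<subseteq> A"
  shows "min (card A) (card B) = card (A \<inter> B)"
  using assms by (metis Int_absorb1 Int_absorb2 card_mono min.absorb1 min.absorb2)

lemma card_eq_sum_color_count:
  assumes "finite S" "\<kappa> ` S \<subseteq> T" "finite T"
  shows "(\<Sum>t\<in>T. color_count \<kappa> S t) = card S"
  using sum.group[OF assms(1,3,2), of "\<lambda>_. 1 :: nat"] by (simp add: color_count_def)

text \<open>If the vertices of each color in two facets form nested sets, the minimum of the two
  counts is the size of their intersection. Summing over the colors then counts
  \<open>F \<inter> F'\<close> exactly once.\<close>

lemma linear_coloringI: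
  assumes fin: "finite (vertices \<Delta>)" and im: "\<kappa> ` vertices \<Delta> = {1..k}"
    and nested: "\<And>F F' t. F \<in> facets \<Delta> \<Longrightarrow> F' \<in> facets \<Delta> \<Longrightarrow>
      {v \<in> F. \<kappa> v = t} \<subseteq> {v \<in> F'. \<kappa> v = t} \<or> {v \<in> F'. \<kappa> v = t} \<subseteq> {v \<in> F. \<kappa> v = t}"
  shows "linear_coloring \<Delta> k \<kappa>"
  unfolding linear_coloring_def
proof (intro conjI ballI im)
  fix F F' assume F: "F \<in> facets \<Delta>" "F' \<in> facets \<Delta>"
  then have sub: "F \<subseteq> vertices \<Delta>" "F' \<subseteq> vertices \<Delta>"
    by (auto simp: facets_def vertices_def)
  then have finF: "finite F" "finite F'"
    using fin finite_subset by blast+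
  have "min (color_count \<kappa> F t) (color_count \<kappa> F' t) = color_count \<kappa> (F \<inter> F') t" for t
  proof -
    have "{v \<in> F. \<kappa> v = t} \<inter> {v \<in> F'. \<kappa> v = t} = {v \<in> F \<inter> F'. \<kappa> v = t}"
      by auto
    then show ?thesis
      using min_card_eq_card_Int[OF _ _ nested[OF F, of t]] finF by (simp add: color_count_def)
  qed
  moreover have "\<kappa> ` (F \<inter> F') \<subseteq> {1..k}"
    using sub im by blast
  ultimately show "(\<Sum>t\<in>{1..k}. min (color_count \<kappa> F t) (color_count \<kappa> F' t)) = card (F \<inter> F')"
    using card_eq_sum_color_count[of "F \<inter> F'" \<kappa> "{1..k}"] finF by simp
qed

text \<open>The only color class with two vertices is \<open>{x, y}\<close>. By domination a facet
  meets it in \<open>{}\<close>, \<open>{y}\<close> or \<open>{x, y}\<close>, and these sets form a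
  chain; so the coloring is linear.\<close>

lemma LC_step_delete_dominated:
  assumes fin: "finite (vertices \<Delta>)" and x: "x \<in> vertices \<Delta>" and y: "y \<in> vertices \<Delta>"
    and "x \<noteq> y" and dom: "facets_at \<Delta> x \<subseteq> facets_at \<Delta> y"
  shows "LC_step \<Delta> {S \<in> \<Delta>. x \<notin> S}"
proof -
  define W where "W = vertices \<Delta> - {x}"
  define k where "k = card W"
  have "finite W" using fin by (simp add: W_def)
  then obtain g where g: "bij_betw g W {1..k}"
    using ex_bij_betw_nat_finite_1 bij_betw_inv k_def by blast
  \<comment> \<open>The bijection \<open>g\<close> numbers all vertices but \<open>x\<close>, and
    \<open>x\<close> borrows the color of \<open>y\<close>.\<close>
  define \<kappa> where "\<kappa> = g(x := g y)"
  have yW: "y \<in> W" using y \<open>x \<noteq> y\<close> by (simp add: W_def)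
  have kW: "\<kappa> v = g v" if "v \<in> W" for v
    using that by (auto simp: \<kappa>_def W_def)
  have same: "u = w \<or> {u, w} = {x, y}"
    if "u \<in> vertices \<Delta>" "w \<in> vertices \<Delta>" "\<kappa> u = \<kappa> w" for u w
  proof -
    have "u = w" if "u \<in> W" "w \<in> W" "g u = g w" for u w
      using that bij_betw_imp_inj_on[OF g] inj_onD by metis
    then show ?thesis
      using that yW kW by (cases "u = x"; cases "w = x") (auto simp: \<kappa>_def W_def)
  qed
  have "vertices \<Delta> = insert x W" using x by (auto simp: W_def)
  moreover have "\<kappa> ` W = g ` W"
    by (rule image_cong[OF refl kW])
  moreover have "\<kappa> x = g y" by (simp add: \<kappa>_def)
  ultimately have "\<kappa> ` vertices \<Delta> = insert (g y) (g ` W)"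
    by simp
  then have im: "\<kappa> ` vertices \<Delta> = {1..k}"
    using g yW by (auto simp: bij_betw_def)
  have xy: "y \<in> F" if "F \<in> facets \<Delta>" "x \<in> F" for F
    using dom that by (auto simp: facets_at_def)
  have V: "F \<subseteq> vertices \<Delta>" if "F \<in> facets \<Delta>" for F
    using that by (auto simp: facets_def vertices_def)
  have lin: "linear_coloring \<Delta> k \<kappa>"
  proof (rule linear_coloringI[OF fin im])
    fix F F' t assume F: "F \<in> facets \<Delta>" "F' \<in> facets \<Delta>"
    show "{v \<in> F. \<kappa> v = t} \<subseteq> {v \<in> F'. \<kappa> v = t} \<or> {v \<in> F'. \<kappa> v = t} \<subseteq> {v \<in> F. \<kappa> v = t}"
    proof (rule ccontr)
      assume not_nested: "\<not> ?thesis"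
      obtain u where u: "u \<in> F" "u \<notin> F'" "\<kappa> u = t"
        using not_nested by auto
      obtain w where w: "w \<in> F'" "w \<notin> F" "\<kappa> w = t"
        using not_nested by auto
      \<comment> \<open>\<open>u\<close> and \<open>w\<close> differ, since only \<open>w\<close>
        lies in \<open>F'\<close>, yet they share the color \<open>t\<close>. Hence one of the two
        facets contains \<open>x\<close> but not \<open>y\<close>, against
        \<open>xy\<close>.\<close>
      have "{u, w} = {x, y}"
        using same[of u w] V[OF F(1)] V[OF F(2)] u w by auto
      then show False using u w xy F by (auto simp: doubleton_eq_iff)
    qed
  qed
  have "representative_subcomplex \<Delta> k \<kappa> {S \<in> \<Delta>. x \<notin> S}"
    unfolding representative_subcomplex_def
  proof (intro exI[of _ W] conjI ballI impI)
    fix t assume "t \<in> {1..k}"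
    then show "\<exists>!v. v \<in> W \<and> \<kappa> v = t"
      using bij_betw_imp_surj_on[OF g] bij_betw_imp_inj_on[OF g] kW
      by (metis imageE inj_onD)
  next
    fix u w assume "u \<in> vertices \<Delta>" "w \<in> W" "\<kappa> u = \<kappa> w"
    \<comment> \<open>\<open>W\<close> omits \<open>x\<close>, so a shared color leaves only the
      pair to which \<open>dom\<close> applies.\<close>
    then have "u = w \<or> (u = x \<and> w = y)"
      using same[of u w] by (auto simp: W_def doubleton_eq_iff)
    then show "facets_at \<Delta> u \<subseteq> facets_at \<Delta> w" using dom by auto
  qed (auto simp: W_def vertices_def)
  then show ?thesis using lin unfolding LC_step_def by blast
qed

text \<open>All members of a facet through \<open>x\<close> are comparable to \<open>x\<close>,
  hence to \<open>y\<close>. Inserting \<open>y\<close> therefore gives a chain again, and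
  maximality puts \<open>y\<close> in the facet already.\<close>

lemma facets_at_order_complex_mono:
  assumes y: "y \<in> Q" "(y, y) \<in> r"
    and comp: "\<And>z. z \<in> Q \<Longrightarrow> (x, z) \<in> r \<or> (z, x) \<in> r \<Longrightarrow> (y, z) \<in> r \<or> (z, y) \<in> r"
  shows "facets_at (order_complex Q r) x \<subseteq> facets_at (order_complex Q r) y"
proof
  fix F assume F: "F \<in> facets_at (order_complex Q r) x"
  then have FC: "F \<in> order_complex Q r" and "x \<in> F"
    and max: "\<forall>G\<in>order_complex Q r. F \<subseteq> G \<longrightarrow> G = F"
    by (auto simp: facets_at_def facets_def)
  have "(y, z) \<in> r \<or> (z, y) \<in> r" if "z \<in> F" for z
    using comp[of z] that FC \<open>x \<in> F\<close> by (auto simp: order_complex_def Chains_def)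
  then have "insert y F \<in> order_complex Q r"
    using FC y by (auto simp: order_complex_def Chains_def)
  then have "y \<in> F" using max by blast
  then show "F \<in> facets_at (order_complex Q r) y"
    using F by (auto simp: facets_at_def)
qed

lemma LC_step_order_complex_delete:
  assumes "finite Q" and r: "refl_on Q r"
    and "x \<in> Q" "y \<in> Q" "x \<noteq> y"
    and comp: "\<And>z. z \<in> Q \<Longrightarrow> (x, z) \<in> r \<or> (z, x) \<in> r \<Longrightarrow> (y, z) \<in> r \<or> (z, y) \<in> r"
  shows "LC_step (order_complex Q r) (order_complex (Q - {x}) r)"
proof -
  have V: "vertices (order_complex Q r) = Q"
  proof
    show "vertices (order_complex Q r) \<subseteq> Q"
      by (auto simp: vertices_def order_complex_def)
    have "{z} \<in> order_complex Q r" if "z \<in> Q" for z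
      using that r by (auto simp: order_complex_def Chains_def dest: refl_onD)
    then show "Q \<subseteq> vertices (order_complex Q r)"
      unfolding vertices_def by blast
  qed
  have "order_complex (Q - {x}) r = {S \<in> order_complex Q r. x \<notin> S}"
    by (auto simp: order_complex_def)
  moreover have "facets_at (order_complex Q r) x \<subseteq> facets_at (order_complex Q r) y"
    by (rule facets_at_order_complex_mono[OF \<open>y \<in> Q\<close> refl_onD[OF r \<open>y \<in> Q\<close>]]) (rule comp)
  ultimately show ?thesis
    using LC_step_delete_dominated[of "order_complex Q r" x y] V assms(1,3-5) by simp
qed

text \<open>Allows elements with \<open>\<phi> x\<close> below \<open>x\<close> to be treated by
  reversing the order.\<close>

lemma closure_operator_converse:
  "closure_operator P (r\<inverse>) \<phi> \<longleftrightarrow> closure_operator P r \<phi>"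
  unfolding closure_operator_def by auto

lemma partial_order_on_maximal:
  assumes po: "partial_order_on P r" and "finite A" "A \<noteq> {}"
  obtains m where "m \<in> A" "\<And>z. z \<in> A \<Longrightarrow> (m, z) \<in> r \<Longrightarrow> z = m"
proof -
  have tr: "trans r" and as: "antisym r"
    using po by (auto simp: partial_order_on_def preorder_on_def)
  have "\<exists>m\<in>A. \<forall>z\<in>A. z \<noteq> m \<longrightarrow> \<not> ((m, z) \<in> r \<and> m \<noteq> z)"
  proof (rule Finite_Set.bex_max_element[OF \<open>finite A\<close> _ _ \<open>A \<noteq> {}\<close>])
    show "asymp_on A (\<lambda>m z. (m, z) \<in> r \<and> m \<noteq> z)"
      using as by (auto simp: asymp_on_def dest: antisymD)
    show "transp_on A (\<lambda>m z. (m, z) \<in> r \<and> m \<noteq> z)"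
      using as tr unfolding transp_on_def trans_def antisym_def by blast
  qed
  then show thesis using that by blast
qed

lemma closure_operator_dominated_above:
  assumes po: "partial_order_on P r" and cl: "closure_operator P r \<phi>"
    and Q: "finite Q" "Q \<subseteq> P" and a: "a \<in> Q" "\<phi> a \<noteq> a" "(a, \<phi> a) \<in> r"
  obtains x where "x \<in> Q" "\<phi> x \<noteq> x"
    "\<And>z. z \<in> Q \<Longrightarrow> (x, z) \<in> r \<or> (z, x) \<in> r \<Longrightarrow> (\<phi> x, z) \<in> r \<or> (z, \<phi> x) \<in> r"
proof -
  have tr: "trans r" using po by (auto simp: partial_order_on_def preorder_on_def)
  let ?A = "{x \<in> Q. \<phi> x \<noteq> x \<and> (x, \<phi> x) \<in> r}"
  \<comment> \<open>Maximality matters for the elements \<open>z\<close> above \<open>x\<close>: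
    apart from \<open>x\<close> itself, none is moved strictly up, so \<open>\<phi> z\<close> lies
    below or equals \<open>z\<close>, and monotonicity puts \<open>\<phi> x\<close> below
    \<open>\<phi> z\<close> and thus below \<open>z\<close>.\<close>
  obtain x where x: "x \<in> ?A" and max: "\<And>z. z \<in> ?A \<Longrightarrow> (x, z) \<in> r \<Longrightarrow> z = x"
    by (rule partial_order_on_maximal[OF po, of ?A]) (use Q a in auto)
  have "(\<phi> x, z) \<in> r \<or> (z, \<phi> x) \<in> r" if "z \<in> Q" "(x, z) \<in> r \<or> (z, x) \<in> r" for z
    using that(2)
  proof
    assume "(z, x) \<in> r"
    then show ?thesis using x tr by (auto dest: transD)
  next
    assume xz: "(x, z) \<in> r"
    then have mono: "(\<phi> x, \<phi> z) \<in> r"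
      using cl x that Q unfolding closure_operator_def by blast
    show ?thesis
    proof (cases "z \<in> ?A")
      case True
      then show ?thesis using max xz x by blast
    next
      case False
      then have "(\<phi> z, z) \<in> r \<or> \<phi> z = z"
        using cl that Q unfolding closure_operator_def by blast
      then show ?thesis using mono tr by (auto dest: transD)
    qed
  qed
  then show thesis using that x by blast
qed

lemma closure_operator_dominated:
  assumes po: "partial_order_on P r" and cl: "closure_operator P r \<phi>"
    and Q: "finite Q" "Q \<subseteq> P" and a: "a \<in> Q" "\<phi> a \<noteq> a"
  obtains x where "x \<in> Q" "\<phi> x \<noteq> x"
    "\<And>z. z \<in> Q \<Longrightarrow> (x, z) \<in> r \<or> (z, x) \<in> r \<Longrightarrow> (\<phi> x, z) \<in> r \<or> (z, \<phi> x) \<in> r"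
proof (cases "(a, \<phi> a) \<in> r")
  case True
  show thesis
    by (rule closure_operator_dominated_above[OF po cl Q a True]) (rule that)
next
  case False
  then have a': "(a, \<phi> a) \<in> r\<inverse>"
    using cl a Q unfolding closure_operator_def by blast
  have po': "partial_order_on P (r\<inverse>)" and cl': "closure_operator P (r\<inverse>) \<phi>"
    using po cl by (simp_all add: closure_operator_converse)
  show thesis
    \<comment> \<open>Comparability is the same for \<open>r\<close> and its converse, so the dual
      conclusion is the desired one.\<close>
    by (rule closure_operator_dominated_above[OF po' cl' Q a a']) (use that in auto)
qed

text \<open>Induction on the size of \<open>Q\<close>, an intermediate stage of the deletion.
  \<open>\<phi>\<close> remains an operator on all of \<open>P\<close>; keeping its image inside
  \<open>Q\<close> ensures that the dominating vertex \<open>\<phi> x\<close> is still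
  present.\<close>

lemma LC_reduces_order_complex_image:
  assumes po: "partial_order_on P r" and cl: "closure_operator P r \<phi>"
    and "finite Q" "\<phi> ` P \<subseteq> Q" "Q \<subseteq> P"
  shows "LC_reduces (order_complex Q r) (order_complex (\<phi> ` P) r)"
  using assms(3-)
proof (induction "card Q" arbitrary: Q rule: less_induct)
  case less
  have idem: "\<And>p. p \<in> P \<Longrightarrow> \<phi> (\<phi> p) = \<phi> p"
    using cl unfolding closure_operator_def by blast
  show ?case
  proof (cases "\<exists>a\<in>Q. \<phi> a \<noteq> a")
    case False
    then have "Q = \<phi> ` P" using less.prems by force
    then show ?thesis by (simp add: LC_reduces_def)
  next
    case True
    then obtain a where a: "a \<in> Q" "\<phi> a \<noteq> a" by blast
    obtain x where x: "x \<in> Q" "\<phi> x \<noteq> x" and comp: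
      "\<And>z. z \<in> Q \<Longrightarrow> (x, z) \<in> r \<or> (z, x) \<in> r \<Longrightarrow> (\<phi> x, z) \<in> r \<or> (z, \<phi> x) \<in> r"
      by (rule closure_operator_dominated[OF po cl less.prems(1,3) a]) (rule that)
    have "refl_on Q r"
      using po less.prems(3) unfolding partial_order_on_def preorder_on_def refl_on_def by blast
    moreover have "\<phi> x \<in> Q" using x less.prems by blast
    ultimately have "LC_step (order_complex Q r) (order_complex (Q - {x}) r)"
      using LC_step_order_complex_delete[OF less.prems(1) _ x(1) _ x(2)[symmetric] comp] by simp
    moreover have "LC_reduces (order_complex (Q - {x}) r) (order_complex (\<phi> ` P) r)"
    proof (rule less.hyps)
      show "card (Q - {x}) < card Q" using less.prems(1) x(1) by (rule card_Diff1_less)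
      \<comment> \<open>By idempotence every element of the image is fixed, whereas \<open>x\<close>
        is not.\<close>
      show "\<phi> ` P \<subseteq> Q - {x}" using less.prems(2) x idem by auto
    qed (use less.prems in auto)
    ultimately show ?thesis
      unfolding LC_reduces_def by (rule converse_rtranclp_into_rtranclp)
  qed
qed

theorem theorem7p7:
  fixes P :: "'a set" and r :: "'a rel" and \<phi> :: "'a \<Rightarrow> 'a"
  assumes "finite P"
    and "partial_order_on P r"
    and "closure_operator P r \<phi>"
  shows "LC_reduces (order_complex P r) (order_complex (\<phi> ` P) (Restr r (\<phi> ` P)))"
proof -
  have "\<phi> ` P \<subseteq> P" using assms(3) by (simp add: closure_operator_def)
  \<comment> \<open>A chain inside the image only involves pairs with both ends there.\<close>
  moreover have "order_complex (\<phi> ` P) (Restr r (\<phi> ` P)) = order_complex (\<phi> ` P) r"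
    by (auto simp: order_complex_def Chains_def)
  ultimately show ?thesis
    using LC_reduces_order_complex_image[OF assms(2,3,1)] by simp
qed

end
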